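(* Let $N,n\ge 1$ be integers, let $A_i\in\mathbf{R}^{n\times n}$ and $\tau_i>0$, $i\in\mathbf{I}[1,N]$, and consider the integral delay system $$x(t)=\sum_{i=1}^{N}A_i\int_{-\tau_i}^{0}x(t+s)\,\mathrm{d}s .$$ Then: 1. The integral delay system is exponentially stable if there exist $N$ positive definite matrices $Q_i\in\mathbf{R}^{n\times n}$, $i\in\mathbf{I}[1,N]$, such that $$\sum_{i=1}^{N}\tau_i^{2}A_i^{\mathrm{T}}Q_i^{-1}A_i-\Big(\sum_{i=1}^{N}Q_i\Big)^{-1}<0.$$ 2. There exist $N$ positive definite matrices $Q_i\in\mathbf{R}^{n\times n}$, $i\in\mathbf{I}[1,N]$, satisfying the nonlinear matrix inequality of item 1 if and only if there exist $N$ positive definite matrices $Q_i\in\mathbf{R}^{n\times n}$, $i\in\mathbf{I}[1,N]$, such that $$\sum_{i=1}^{N}\begin{bmatrix}\tau_1A_1\\ \vdots\\ \tau_NA_N\end{bmatrix}Q_i\begin{bmatrix}\tau_1A_1\\ \vdots\\ \tau_NA_N\end{bmatrix}^{\mathrm{T}}-\begin{bmatrix}Q_1&&\\&\ddots&\\&&Q_N\end{bmatrix}<0.$$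
   Context: Notation: $\mathbf{I}[1,N]=\{1,2,\ldots,N\}$. Positive definite matrices are real symmetric; for symmetric matrices, $X<Y$ means that $Y-X$ is positive definite. The last matrix in item 2 is block diagonal with diagonal blocks $Q_1,\ldots,Q_N$. Let $\tau=\max_{i\in\mathbf{I}[1,N]}\tau_i$ and let $\mathscr{C}_{n,\tau}$ be the Banach space of continuous functions from $[-\tau,0]$ to $\mathbf{R}^n$ with the topology of uniform convergence. For an initial condition $\varphi\in\mathscr{C}_{n,\tau}$, the solution $x(t)=x(t,\varphi)$ satisfies $x(t)=\varphi(t)$ for $t\in[-\tau,0)$ and the integral delay system for all $t\ge 0$. The system is exponentially stable if there exist positive constants $\alpha,\beta$ (independent of $\varphi$) such that $\|x(t)\|\le\alpha\sup_{s\in[-\tau,0)}\|\varphi(s)\|\,\mathrm{e}^{-\beta t}$ for all $t\ge0$ and all initial conditions $\varphi$. *)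

theory Defs
  imports "HOL-Analysis.Analysis"
begin

definition pos_def :: "real ^ 'n ^ 'n \<Rightarrow> bool" where
  "pos_def M \<longleftrightarrow> transpose M = M \<and> (\<forall>v. v \<noteq> 0 \<longrightarrow> 0 < v \<bullet> (M *v v))"

text \<open>The order \<open>X < Y\<close> on symmetric matrices. The library's \<open><\<close> on \<^typ>\<open>real ^ 'n ^ 'n\<close> is the
  componentwise order and is not what is meant here.\<close>

definition loewner_less :: "real ^ 'n ^ 'n \<Rightarrow> real ^ 'n ^ 'n \<Rightarrow> bool" (infix "\<prec>" 50) where
  "X \<prec> Y \<longleftrightarrow> pos_def (Y - X)"

text \<open>Block matrices use pairs \<open>(i, k)\<close> as indices: \<open>i\<close> is the block and \<open>k\<close> the position inside it.\<close>

definition block_column :: "('N \<Rightarrow> real ^ 'n ^ 'n) \<Rightarrow> real ^ 'n ^ ('N::finite \<times> 'n::finite)" where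
  "block_column B = (\<chi> p q. B (fst p) $ snd p $ q)"

definition block_diag ::
  "('N \<Rightarrow> real ^ 'n ^ 'n) \<Rightarrow> real ^ ('N::finite \<times> 'n::finite) ^ ('N \<times> 'n)" where
  "block_diag Q = (\<chi> p q. if fst p = fst q then Q (fst p) $ snd p $ snd q else 0)"

definition max_delay :: "('N::finite \<Rightarrow> real) \<Rightarrow> real" where
  "max_delay \<tau> = Max (range \<tau>)"

text \<open>Integrability is required explicitly because \<^const>\<open>integral\<close> is \<open>0\<close> on non-integrable
  functions. The prescribed values are those on the half-open interval \<open>[-max_delay \<tau>, 0)\<close>: at
  \<open>t = 0\<close> the equation holds instead, so \<open>x\<close> may jump there and \<open>x 0\<close> need not be \<open>\<phi> 0\<close>.\<close>

definition ids_solution ::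
  "('N::finite \<Rightarrow> real ^ 'n ^ 'n) \<Rightarrow> ('N \<Rightarrow> real) \<Rightarrow> (real \<Rightarrow> real ^ 'n) \<Rightarrow> (real \<Rightarrow> real ^ 'n) \<Rightarrow> bool"
where
  "ids_solution A \<tau> \<phi> x \<longleftrightarrow>
     (\<forall>t\<in>{- max_delay \<tau>..<0}. x t = \<phi> t) \<and>
     (\<forall>t\<ge>0. (\<forall>i. (\<lambda>s. x (t + s)) integrable_on {- \<tau> i..0}) \<and>
             x t = (\<Sum>i\<in>UNIV. A i *v integral {- \<tau> i..0} (\<lambda>s. x (t + s))))"

definition ids_exponentially_stable ::
  "('N::finite \<Rightarrow> real ^ 'n ^ 'n) \<Rightarrow> ('N \<Rightarrow> real) \<Rightarrow> bool" where
  "ids_exponentially_stable A \<tau> \<longleftrightarrow>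
     (\<exists>\<alpha>>0. \<exists>\<beta>>0. \<forall>\<phi> x.
        continuous_on {- max_delay \<tau>..0} \<phi> \<longrightarrow> ids_solution A \<tau> \<phi> x \<longrightarrow>
        (\<forall>t\<ge>0. norm (x t) \<le> \<alpha> * (SUP s\<in>{- max_delay \<tau>..<0}. norm (\<phi> s)) * exp (- \<beta> * t)))"

end

theory Submission
  imports Defs
begin

text \<open>The stability criterion rests on two convexity inequalities. Write \<open>P = (\<Sum>i. Q i)\<inverse>\<close> and
  \<open>R i = (A i)\<^sup>T (Q i)\<inverse> A i\<close>. The system expresses \<open>x t\<close> as a sum of \<open>N\<close> vectors \<open>A i (\<integral> x)\<close>, the integral
  being over the window \<open>{t - \<tau> i..t}\<close>. Joint convexity of \<open>(Q, y) \<mapsto> y \<bullet> Q\<inverse> y\<close> (\<open>quadratic_sum_le\<close>) bounds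
  the \<open>P\<close>-form of the sum by the sum of the \<open>(Q i)\<inverse>\<close>-forms, and the Cauchy-Schwarz inequality
  (\<open>quadratic_integral_Cauchy_Schwarz\<close>) moves each form under its integral. The result is
  \<open>x t \<bullet> P (x t) \<le> (\<Sum>i. \<tau> i * (\<integral> x r \<bullet> R i (x r) dr))\<close>.

  If this is integrated in \<open>t\<close>, each window integral contributes a further factor \<open>\<tau> i\<close>, and
  \<open>(\<Sum>i. (\<tau> i)\<^sup>2 R i) < P\<close> is exactly what lets the left-hand side absorb the right-hand side up to
  the initial data. The inequality is strict, so there is room for a small exponential weight, and
  the bound becomes exponential decay (\<open>delay_inequality_exponential_decay\<close>).

  The equivalence of the two matrix inequalities holds for each \<open>Q\<close> separately. With \<open>D\<close> the block
  diagonal matrix of the \<open>Q i\<close>, \<open>S\<close> their sum and \<open>B\<close> the block column of the \<open>\<tau> i A i\<close>, they read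
  \<open>B\<^sup>T D\<inverse> B < S\<inverse>\<close> and \<open>B S B\<^sup>T < D\<close>, the two Schur complements of one block matrix
  (\<open>schur_complement_iff\<close>).\<close>

section \<open>Positive definite matrices and their inverses\<close>

text \<open>The default simplification \<open>transpose M *v v = v v* M\<close> would hide products with a transpose from
  the lemmas on \<open>*v\<close>.\<close>

declare transpose_matrix_vector [simp del] vector_transpose_matrix [simp del]

lemma inner_matrix_vector_transpose:
  fixes M :: "real ^ 'n ^ 'm"
  shows "v \<bullet> (M *v w) = (transpose M *v v) \<bullet> w"
  by (simp add: dot_lmul_matrix transpose_matrix_vector)

lemma transpose_diff: "transpose (M - M' :: real ^ 'n ^ 'm) = transpose M - transpose M'"
  by (simp add: transpose_def vec_eq_iff)

lemma transpose_sum: "transpose (\<Sum>i\<in>I. M i :: real ^ 'n ^ 'm) = (\<Sum>i\<in>I. transpose (M i))"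
  by (simp add: transpose_def vec_eq_iff sum_component)

lemma matrix_vector_mult_sum_left:
  "(\<Sum>i\<in>I. M i :: real ^ 'n ^ 'm) *v v = (\<Sum>i\<in>I. M i *v v)"
  by (induction I rule: infinite_finite_induct) (auto simp: algebra_simps)

lemma quadratic_form_diff:
  fixes X Y :: "real ^ 'n ^ 'n"
  shows "v \<bullet> ((X - Y) *v v) = v \<bullet> (X *v v) - v \<bullet> (Y *v v)"
  by (simp add: algebra_simps inner_diff_right)

lemma loewner_less_diff_zero: "X - Y \<prec> 0 \<longleftrightarrow> pos_def (Y - X)"
  by (simp add: loewner_less_def)

lemma pos_def_symmetric:
  assumes "pos_def M"
  shows "transpose M = M" "v \<bullet> (M *v w) = (M *v v) \<bullet> w"
  using assms inner_matrix_vector_transpose[of v M w] by (auto simp: pos_def_def)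

lemma pos_def_nonneg: "pos_def M \<Longrightarrow> 0 \<le> v \<bullet> (M *v v)"
  by (cases "v = 0") (auto simp: pos_def_def intro: less_imp_le)

lemma pos_def_inverse:
  fixes M :: "real ^ 'n ^ 'n"
  assumes "pos_def M"
  shows "M ** matrix_inv M = mat 1" "matrix_inv M ** M = mat 1"
    "M *v (matrix_inv M *v v) = v" "matrix_inv M *v (M *v v) = v"
    "pos_def (matrix_inv M)"
proof -
  have "inj ((*v) M)"
  proof (rule injI)
    fix v w assume "M *v v = M *v w"
    then have "(v - w) \<bullet> (M *v (v - w)) = 0"
      by (simp add: algebra_simps)
    then have "\<not> v - w \<noteq> 0"
      using assms unfolding pos_def_def by (metis less_irrefl)
    then show "v = w"
      by simp
  qed
  then have "invertible M"
    by (simp add: invertible_left_inverse matrix_left_invertible_injective)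
  then have "\<exists>M'. M ** M' = mat 1 \<and> M' ** M = mat 1"
    by (simp add: invertible_def)
  then have *: "M ** matrix_inv M = mat 1 \<and> matrix_inv M ** M = mat 1"
    unfolding matrix_inv_def by (rule someI_ex)
  show "M ** matrix_inv M = mat 1" "matrix_inv M ** M = mat 1"
    using * by auto
  show inv: "M *v (matrix_inv M *v v) = v" "matrix_inv M *v (M *v v) = v" for v
    using * by (simp_all add: matrix_vector_mul_assoc)
  have "transpose (matrix_inv M) = transpose (matrix_inv M) ** (M ** matrix_inv M)"
    using * by simp
  also have "\<dots> = transpose (M ** matrix_inv M) ** matrix_inv M"
    by (simp add: matrix_transpose_mul matrix_mul_assoc pos_def_symmetric[OF assms])
  also have "\<dots> = matrix_inv M"
    using * by simp
  finally have "transpose (matrix_inv M) = matrix_inv M" .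
  moreover have "0 < v \<bullet> (matrix_inv M *v v)" if "v \<noteq> 0" for v
  proof -
    have "matrix_inv M *v v \<noteq> 0"
      using that inv(1)[of v] by force
    then have "0 < (matrix_inv M *v v) \<bullet> (M *v (matrix_inv M *v v))"
      using assms unfolding pos_def_def by blast
    then show ?thesis
      by (simp add: inv inner_commute)
  qed
  ultimately show "pos_def (matrix_inv M)"
    by (simp add: pos_def_def)
qed

lemma matrix_inv_unique:
  fixes M M' :: "real ^ 'n ^ 'n"
  assumes "M ** M' = mat 1"
  shows "matrix_inv M = M'"
proof -
  have left: "M' ** M = mat 1"
    using assms matrix_left_right_inverse by blast
  then have "\<exists>M'. M ** M' = mat 1 \<and> M' ** M = mat 1"
    using assms by blast
  then have "matrix_inv M ** M = mat 1"
    unfolding matrix_inv_def by (rule someI2_ex) auto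
  then show ?thesis
    by (metis assms matrix_mul_assoc matrix_mul_lid matrix_mul_rid)
qed

lemma pos_def_inverse_inverse:
  fixes M :: "real ^ 'n ^ 'n"
  assumes "pos_def M"
  shows "matrix_inv (matrix_inv M) = M"
  using pos_def_inverse[OF assms] matrix_inv_unique by blast

lemma pos_def_sum:
  fixes Q :: "'i \<Rightarrow> real ^ 'n ^ 'n"
  assumes "finite I" "I \<noteq> {}" "\<And>i. i \<in> I \<Longrightarrow> pos_def (Q i)"
  shows "pos_def (\<Sum>i\<in>I. Q i)"
  using assms
  by (auto simp: pos_def_def transpose_sum matrix_vector_mult_sum_left inner_sum_right
      intro!: sum_pos)

text \<open>The constant is the minimum of the form on the compact unit sphere.\<close>

lemma pos_def_coercive:
  fixes M :: "real ^ 'n ^ 'n"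
  assumes "pos_def M"
  obtains d where "d > 0" "\<And>v. d * (v \<bullet> v) \<le> v \<bullet> (M *v v)"
proof -
  have "\<exists>u\<in>sphere 0 1. \<forall>v\<in>sphere 0 1. u \<bullet> (M *v u) \<le> v \<bullet> (M *v v)"
    by (rule continuous_attains_inf) (auto intro!: continuous_intros)
  then obtain u where u: "norm u = 1" "\<And>v. norm v = 1 \<Longrightarrow> u \<bullet> (M *v u) \<le> v \<bullet> (M *v v)"
    by auto
  define d where "d = u \<bullet> (M *v u)"
  have "u \<noteq> 0"
    using u(1) by auto
  then have "d > 0"
    using assms unfolding d_def pos_def_def by blast
  moreover have "d * (v \<bullet> v) \<le> v \<bullet> (M *v v)" for v
  proof (cases "v = 0")
    case False
    define w where "w = v /\<^sub>R norm v"
    have v: "v = norm v *\<^sub>R w" "norm w = 1"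
      using False by (auto simp: w_def)
    have "d * (norm v)\<^sup>2 \<le> (w \<bullet> (M *v w)) * (norm v)\<^sup>2"
      using u(2)[OF v(2)] by (intro mult_right_mono) (auto simp: d_def)
    also have "\<dots> = v \<bullet> (M *v v)"
    proof -
      have "v \<bullet> (M *v v) = (norm v *\<^sub>R w) \<bullet> (M *v (norm v *\<^sub>R w))"
        using v(1) by simp
      then show ?thesis
        by (simp add: matrix_vector_mult_scaleR power2_eq_square)
    qed
    finally show ?thesis
      by (simp add: power2_norm_eq_inner)
  qed simp
  ultimately show thesis
    using that by blast
qed

lemma quadratic_form_bound:
  fixes M :: "real ^ 'n ^ 'n"
  obtains c where "c > 0" "\<And>v. v \<bullet> (M *v v) \<le> c * (v \<bullet> v)"
proof -
  obtain c where c: "c > 0" "\<And>v. norm (M *v v) \<le> norm v * c"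
    using bounded_linear.pos_bounded[OF matrix_vector_mul_bounded_linear[of M]] by auto
  have "v \<bullet> (M *v v) \<le> c * (v \<bullet> v)" for v
  proof -
    have "v \<bullet> (M *v v) \<le> norm v * norm (M *v v)"
      by (rule norm_cauchy_schwarz)
    also have "\<dots> \<le> norm v * (norm v * c)"
      using c by (intro mult_left_mono) auto
    finally show ?thesis
      by (simp add: dot_square_norm power2_eq_square mult_ac)
  qed
  with c show thesis
    using that by blast
qed

text \<open>The function \<open>(Q, y) \<mapsto> y \<bullet> Q\<inverse> y\<close> is subadditive, because it is a supremum of linear functions:
  \<open>y \<bullet> Q\<inverse> y \<ge> 2 (w \<bullet> y) - w \<bullet> Q w\<close> for every \<open>w\<close>, which is nonnegativity of the \<open>Q\<inverse>\<close>-form at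
  \<open>y - Q w\<close>. Summing these bounds with the \<open>w\<close> that is optimal for the sums gives the claim. This is
  where \<open>(\<Sum>i. Q i)\<inverse>\<close> enters the stability criterion.\<close>

lemma quadratic_sum_le:
  fixes Q :: "'i \<Rightarrow> real ^ 'n ^ 'n" and y :: "'i \<Rightarrow> real ^ 'n"
  assumes "finite I" "I \<noteq> {}" and Q: "\<And>i. i \<in> I \<Longrightarrow> pos_def (Q i)"
  shows "(\<Sum>i\<in>I. y i) \<bullet> (matrix_inv (\<Sum>i\<in>I. Q i) *v (\<Sum>i\<in>I. y i))
    \<le> (\<Sum>i\<in>I. y i \<bullet> (matrix_inv (Q i) *v y i))"
proof -
  define S where "S = (\<Sum>i\<in>I. Q i)"
  define x where "x = (\<Sum>i\<in>I. y i)"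
  define w where "w = matrix_inv S *v x"
  have S: "pos_def S"
    unfolding S_def using assms by (rule pos_def_sum)
  have "2 * (w \<bullet> y i) - w \<bullet> (Q i *v w) \<le> y i \<bullet> (matrix_inv (Q i) *v y i)" if "i \<in> I" for i
  proof -
    note Qi = pos_def_inverse[OF Q[OF that]]
    have "0 \<le> (y i - Q i *v w) \<bullet> (matrix_inv (Q i) *v (y i - Q i *v w))"
      using Qi(5) by (rule pos_def_nonneg)
    also have "\<dots> = y i \<bullet> (matrix_inv (Q i) *v y i) - y i \<bullet> w
        - (Q i *v w) \<bullet> (matrix_inv (Q i) *v y i) + (Q i *v w) \<bullet> w"
      by (simp add: matrix_vector_mult_diff_distrib Qi inner_diff)
    also have "(Q i *v w) \<bullet> (matrix_inv (Q i) *v y i) = w \<bullet> y i"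
      by (metis Qi(3) pos_def_symmetric(2)[OF Q[OF that]])
    finally show ?thesis
      by (simp add: inner_commute)
  qed
  then have "(\<Sum>i\<in>I. 2 * (w \<bullet> y i) - w \<bullet> (Q i *v w)) \<le> (\<Sum>i\<in>I. y i \<bullet> (matrix_inv (Q i) *v y i))"
    by (rule sum_mono)
  also have "(\<Sum>i\<in>I. 2 * (w \<bullet> y i) - w \<bullet> (Q i *v w)) = 2 * (w \<bullet> x) - w \<bullet> (S *v w)"
    by (simp add: sum_subtractf S_def x_def matrix_vector_mult_sum_left inner_sum_right sum_distrib_left)
  also have "\<dots> = x \<bullet> (matrix_inv S *v x)"
    by (simp add: w_def pos_def_inverse[OF S] inner_commute)
  finally show ?thesis
    by (simp add: S_def x_def)
qed

section \<open>Schur complements and block matrices\<close>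

text \<open>Both inequalities say that the block matrix with diagonal blocks \<open>S\<inverse>\<close>, \<open>D\<close> and off-diagonal
  blocks \<open>B\<^sup>T\<close>, \<open>B\<close> is positive definite. For a direct argument, take \<open>z = D\<inverse> B v\<close> and \<open>u = B\<^sup>T z\<close>; the
  number \<open>a = u \<bullet> v\<close> equals \<open>z \<bullet> D z\<close>. The hypothesis at \<open>z\<close> reads \<open>u \<bullet> S u < a\<close>, and nonnegativity
  of the \<open>S\<inverse>\<close>-form at \<open>v - S u\<close> reads \<open>2 a - u \<bullet> S u \<le> v \<bullet> S\<inverse> v\<close>; together \<open>a < v \<bullet> S\<inverse> v\<close>.
  If \<open>z = 0\<close>, then \<open>B v = 0\<close> and only the positivity of \<open>S\<inverse>\<close> is left.\<close>

lemma schur_complement_swap: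
  fixes D :: "real ^ 'm ^ 'm" and S :: "real ^ 'n ^ 'n" and B :: "real ^ 'n ^ 'm"
  assumes D: "pos_def D" and S: "pos_def S"
    and less: "pos_def (D - B ** S ** transpose B)"
  shows "pos_def (matrix_inv S - transpose B ** matrix_inv D ** B)"
  unfolding pos_def_def
proof (intro conjI allI impI)
  note D' = pos_def_inverse[OF D] and S' = pos_def_inverse[OF S]
  show "transpose (matrix_inv S - transpose B ** matrix_inv D ** B)
      = matrix_inv S - transpose B ** matrix_inv D ** B"
    by (simp add: transpose_diff matrix_transpose_mul matrix_mul_assoc
        pos_def_symmetric[OF D'(5)] pos_def_symmetric[OF S'(5)])
  fix v :: "real ^ 'n" assume "v \<noteq> 0"
  define z where "z = matrix_inv D *v (B *v v)"
  define u where "u = transpose B *v z"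
  have Dz: "D *v z = B *v v"
    by (simp add: z_def D')
  have "0 < v \<bullet> (matrix_inv S *v v) - (B *v v) \<bullet> z"
  proof (cases "z = 0")
    case True
    then show ?thesis
      using S'(5) \<open>v \<noteq> 0\<close> by (simp add: pos_def_def)
  next
    case False
    have uv: "u \<bullet> v = (B *v v) \<bullet> z"
      unfolding u_def using inner_matrix_vector_transpose[of z B v] by (simp add: inner_commute)
    have "0 < z \<bullet> ((D - B ** S ** transpose B) *v z)"
      using less False by (simp add: pos_def_def)
    also have "\<dots> = (B *v v) \<bullet> z - u \<bullet> (S *v u)"
      using inner_matrix_vector_transpose[of z B "S *v u"]
      by (simp add: quadratic_form_diff Dz u_def inner_commute flip: matrix_vector_mul_assoc)
    finally have 1: "u \<bullet> (S *v u) < (B *v v) \<bullet> z"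
      by simp
    have "0 \<le> (v - S *v u) \<bullet> (matrix_inv S *v (v - S *v u))"
      using S'(5) by (rule pos_def_nonneg)
    also have "\<dots> = v \<bullet> (matrix_inv S *v v) - v \<bullet> u - (S *v u) \<bullet> (matrix_inv S *v v) + (S *v u) \<bullet> u"
      by (simp add: matrix_vector_mult_diff_distrib S' inner_diff)
    also have "(S *v u) \<bullet> (matrix_inv S *v v) = u \<bullet> v"
      by (metis S'(3) pos_def_symmetric(2)[OF S])
    finally have "2 * (u \<bullet> v) - u \<bullet> (S *v u) \<le> v \<bullet> (matrix_inv S *v v)"
      by (simp add: inner_commute)
    with 1 uv show ?thesis
      by linarith
  qed
  also have "\<dots> = v \<bullet> ((matrix_inv S - transpose B ** matrix_inv D ** B) *v v)"
    using inner_matrix_vector_transpose[of v "transpose B" z]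
    by (simp add: quadratic_form_diff z_def flip: matrix_vector_mul_assoc)
  finally show "0 < v \<bullet> ((matrix_inv S - transpose B ** matrix_inv D ** B) *v v)" .
qed

text \<open>The converse implication is the same one, applied to \<open>S\<inverse>\<close>, \<open>D\<inverse>\<close> and \<open>B\<^sup>T\<close> in place of \<open>D\<close>, \<open>S\<close>
  and \<open>B\<close>.\<close>

lemma schur_complement_iff:
  fixes D :: "real ^ 'm ^ 'm" and S :: "real ^ 'n ^ 'n" and B :: "real ^ 'n ^ 'm"
  assumes D: "pos_def D" and S: "pos_def S"
  shows "pos_def (matrix_inv S - transpose B ** matrix_inv D ** B)
    \<longleftrightarrow> pos_def (D - B ** S ** transpose B)"
  using schur_complement_swap[OF D S, of B]
    schur_complement_swap[OF pos_def_inverse(5)[OF S] pos_def_inverse(5)[OF D], of "transpose B"]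
  by (auto simp: pos_def_inverse_inverse D S)

lemma sum_UNIV_pair:
  fixes f :: "'N::finite \<times> 'n::finite \<Rightarrow> 'a::comm_monoid_add"
  shows "(\<Sum>p\<in>UNIV. f p) = (\<Sum>i\<in>UNIV. \<Sum>k\<in>UNIV. f (i, k))"
  by (simp add: sum.cartesian_product flip: UNIV_Times_UNIV)

lemma sum_block_delta:
  fixes f :: "'N::finite \<times> 'n::finite \<Rightarrow> 'a::comm_monoid_add"
  shows "(\<Sum>p\<in>UNIV. if i = fst p then f p else 0) = (\<Sum>k\<in>UNIV. f (i, k))"
proof -
  have "(\<Sum>k\<in>UNIV. if i = j then f (j, k) else 0) = (if i = j then \<Sum>k\<in>UNIV. f (i, k) else 0)" for j
    by simp
  then show ?thesis
    by (simp add: sum_UNIV_pair)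
qed

lemma if_zero_mult: "(if b then x else 0) * y = (if b then x * y else (0 :: 'a :: mult_zero))"
  by simp

lemma block_diag_mult_block_column:
  fixes Q B :: "'N::finite \<Rightarrow> real ^ 'n::finite ^ 'n"
  shows "block_diag Q ** block_column B = block_column (\<lambda>i. Q i ** B i)"
  by (simp add: vec_eq_iff matrix_matrix_mult_def block_diag_def block_column_def if_zero_mult
      sum_block_delta)

lemma block_diag_mult_block_diag:
  fixes Q R :: "'N::finite \<Rightarrow> real ^ 'n::finite ^ 'n"
  shows "block_diag Q ** block_diag R = block_diag (\<lambda>i. Q i ** R i)"
  by (simp add: vec_eq_iff matrix_matrix_mult_def block_diag_def if_zero_mult sum_block_delta)

lemma transpose_block_column_mult:
  fixes B C :: "'N::finite \<Rightarrow> real ^ 'n::finite ^ 'n"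
  shows "transpose (block_column B) ** block_column C = (\<Sum>i\<in>UNIV. transpose (B i) ** C i)"
  by (simp add: vec_eq_iff matrix_matrix_mult_def block_column_def sum_UNIV_pair transpose_def)

lemma block_diag_inverse:
  fixes Q :: "'N::finite \<Rightarrow> real ^ 'n::finite ^ 'n"
  assumes "\<And>i. pos_def (Q i)"
  shows "matrix_inv (block_diag Q) = block_diag (\<lambda>i. matrix_inv (Q i))"
proof (rule matrix_inv_unique)
  have "block_diag (\<lambda>i :: 'N. mat 1) = (mat 1 :: real ^ ('N \<times> 'n) ^ ('N \<times> 'n))"
    by (auto simp: block_diag_def mat_def vec_eq_iff)
  then show "block_diag Q ** block_diag (\<lambda>i. matrix_inv (Q i)) = mat 1"
    by (simp add: block_diag_mult_block_diag pos_def_inverse(1)[OF assms])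
qed

lemma pos_def_block_diag:
  fixes Q :: "'N::finite \<Rightarrow> real ^ 'n::finite ^ 'n"
  assumes "\<And>i. pos_def (Q i)"
  shows "pos_def (block_diag Q)"
  unfolding pos_def_def
proof (intro conjI allI impI)
  have "Q i $ a $ b = Q i $ b $ a" for i a b
    using arg_cong[OF pos_def_symmetric(1)[OF assms[of i]], of "\<lambda>M. M $ b $ a"]
    by (simp add: transpose_def)
  then show "transpose (block_diag Q) = block_diag Q"
    by (auto simp: transpose_def block_diag_def vec_eq_iff)
  fix w :: "real ^ ('N \<times> 'n)" assume "w \<noteq> 0"
  define part where "part i = (\<chi> k. w $ (i, k))" for i
  have "w \<bullet> (block_diag Q *v w) = (\<Sum>i\<in>UNIV. part i \<bullet> (Q i *v part i))"
    by (simp add: inner_vec_def matrix_vector_mult_def block_diag_def part_def if_zero_mult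
        sum_block_delta sum_UNIV_pair[of "\<lambda>p. w $ p * _ p"])
  moreover obtain i where "part i \<noteq> 0"
    using \<open>w \<noteq> 0\<close> by (auto simp: vec_eq_iff part_def)
  ultimately show "0 < w \<bullet> (block_diag Q *v w)"
    using assms pos_def_nonneg[OF assms]
    by (auto simp: pos_def_def intro!: sum_pos2[where i=i])
qed

section \<open>Integral inequalities\<close>

text \<open>The integral of the form at \<open>x r - c\<close> is nonnegative, where \<open>c\<close> is the mean value of \<open>x\<close>.\<close>

lemma quadratic_integral_Cauchy_Schwarz:
  fixes x :: "real \<Rightarrow> real ^ 'n" and R :: "real ^ 'n ^ 'n"
  assumes R: "\<And>v. 0 \<le> v \<bullet> (R *v v)"
    and x: "x integrable_on {a..b}"
    and q: "(\<lambda>r. x r \<bullet> (R *v x r)) integrable_on {a..b}"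
    and "a \<le> b"
  shows "integral {a..b} x \<bullet> (R *v integral {a..b} x)
    \<le> (b - a) * integral {a..b} (\<lambda>r. x r \<bullet> (R *v x r))"
proof (cases "a = b")
  case False
  with \<open>a \<le> b\<close> have ab: "b - a > 0"
    by simp
  define y where "y = integral {a..b} x"
  define c where "c = y /\<^sub>R (b - a)"
  define J where "J = integral {a..b} (\<lambda>r. x r \<bullet> (R *v x r))"
  have y: "(x has_integral y) {a..b}"
    unfolding y_def using x by (rule integrable_integral)
  have "((\<lambda>r. x r \<bullet> (R *v c)) has_integral y \<bullet> (R *v c)) {a..b}"
    using has_integral_linear[OF y bounded_linear_inner_left] by (simp add: o_def)
  moreover have "((\<lambda>r. c \<bullet> (R *v x r)) has_integral c \<bullet> (R *v y)) {a..b}"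
    using has_integral_linear[OF has_integral_linear[OF y matrix_vector_mul_bounded_linear]
        bounded_linear_inner_right] by (simp add: o_def)
  moreover have "((\<lambda>r. x r \<bullet> (R *v x r)) has_integral J) {a..b}"
    unfolding J_def using q by (rule integrable_integral)
  moreover have "((\<lambda>r. c \<bullet> (R *v c)) has_integral (b - a) * (c \<bullet> (R *v c))) {a..b}"
    using has_integral_const_real[of "c \<bullet> (R *v c)" a b] \<open>a \<le> b\<close> by simp
  ultimately have "((\<lambda>r. x r \<bullet> (R *v x r) - x r \<bullet> (R *v c) - c \<bullet> (R *v x r) + c \<bullet> (R *v c))
      has_integral J - y \<bullet> (R *v c) - c \<bullet> (R *v y) + (b - a) * (c \<bullet> (R *v c))) {a..b}"
    by (intro has_integral_add has_integral_diff)
  moreover have "(x r - c) \<bullet> (R *v (x r - c)) =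
      x r \<bullet> (R *v x r) - x r \<bullet> (R *v c) - c \<bullet> (R *v x r) + c \<bullet> (R *v c)" for r
    by (simp add: matrix_vector_mult_diff_distrib inner_diff)
  ultimately have "0 \<le> J - y \<bullet> (R *v c) - c \<bullet> (R *v y) + (b - a) * (c \<bullet> (R *v c))"
    by (metis (no_types, lifting) R has_integral_nonneg)
  also have "\<dots> = J - (y \<bullet> (R *v y)) / (b - a)"
    using ab by (simp add: c_def matrix_vector_mult_scaleR divide_inverse)
  finally show ?thesis
    using ab by (simp add: J_def y_def field_simps)
qed simp

text \<open>With the primitive \<open>G\<close> of \<open>q\<close> the window integral is \<open>G t - G (t - d)\<close>, and its integral
  telescopes to the integral of \<open>G\<close> over \<open>{T - d..T}\<close> minus the one over \<open>{- d..0}\<close>. As \<open>G\<close> is monotone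
  and nonnegative, only \<open>d * G T\<close> can remain. Working with a primitive replaces an exchange of the
  order of integration.\<close>

lemma integral_sliding_window:
  fixes q :: "real \<Rightarrow> real"
  assumes q: "q integrable_on {-d..T}" "\<And>r. 0 \<le> q r" and "0 \<le> d" "0 \<le> T"
  shows "(\<lambda>t. integral {t - d..t} q) integrable_on {0..T}" (is ?int)
    and "integral {0..T} (\<lambda>t. integral {t - d..t} q) \<le> d * integral {-d..T} q" (is ?le)
proof -
  define G where "G t = integral {-d..t} q" for t
  have sub: "q integrable_on {a..b}" if "-d \<le> a" "b \<le> T" for a b
    using q(1) by (rule integrable_subinterval_real) (use that in auto)
  have window: "integral {t - d..t} q = G t - G (t - d)" if "t \<in> {0..T}" for t
    using Henstock_Kurzweil_Integration.integral_combine[of "-d" "t - d" t q] that \<open>0 \<le> d\<close> sub unfolding G_def by auto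
  have contG: "continuous_on {-d..T} G"
    unfolding G_def using q(1) by (rule indefinite_integral_continuous_1)
  then have intG: "G integrable_on {a..b}" if "-d \<le> a" "b \<le> T" for a b
    by (rule integrable_continuous_interval[OF continuous_on_subset]) (use that in auto)
  have G_nonneg: "0 \<le> G t" if "t \<le> T" for t
    unfolding G_def using sub[of "-d" t] that q(2) by (intro integral_nonneg) auto
  have G_le: "G t \<le> G T" if "t \<le> T" for t
    unfolding G_def using sub that q(2) \<open>0 \<le> T\<close> \<open>0 \<le> d\<close>
    by (intro integral_subset_le) auto
  have shift: "((\<lambda>t. G (t - d)) has_integral integral {-d..T - d} G) {0..T}"
    using has_integral_shift_real_ivl[OF integrable_integral[OF intG[of "-d" "T - d"]], of "-d"]
      \<open>0 \<le> d\<close> by simp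
  have *: "((\<lambda>t. integral {t - d..t} q) has_integral integral {0..T} G - integral {-d..T - d} G) {0..T}"
  proof (rule has_integral_eq)
    show "((\<lambda>t. G t - G (t - d)) has_integral integral {0..T} G - integral {-d..T - d} G) {0..T}"
      using \<open>0 \<le> d\<close> by (intro has_integral_diff shift integrable_integral intG) auto
  qed (simp add: window)
  then show ?int
    by blast
  have "integral {-d..0} G + integral {0..T} G = integral {-d..T - d} G + integral {T - d..T} G"
    using assms(3,4) intG[of "-d" T] by (simp add: Henstock_Kurzweil_Integration.integral_combine)
  moreover have "0 \<le> integral {-d..0} G"
    using \<open>0 \<le> T\<close> by (intro integral_nonneg intG G_nonneg) auto
  moreover have "integral {T - d..T} G \<le> integral {T - d..T} (\<lambda>t. G T)"
    using \<open>0 \<le> T\<close> by (intro integral_le intG G_le) auto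
  ultimately show ?le
    using * \<open>0 \<le> d\<close> by (simp add: integral_unique G_def)
qed

text \<open>The heart of the stability proof. A solution is seen only through the scalar delay inequality for
  its quadratic forms, so the linear system no longer occurs; \<open>\<alpha>\<close> and \<open>\<beta>\<close> are found before \<open>x\<close>.

  The inequality is multiplied by the weight \<open>exp (g * t)\<close> and integrated over \<open>{0..T}\<close>. Moving the
  weight into a window of length \<open>\<tau> i \<le> m\<close> costs at most the factor \<open>exp (g * m) = 1 + \<eta>\<close>, and
  integrating the window integrals costs another factor \<open>\<tau> i\<close>. So the weighted integral of \<open>P\<close> over
  \<open>{0..T}\<close> is at most \<open>1 + \<eta>\<close> times that of \<open>F = (\<Sum>i. (\<tau> i)\<^sup>2 R i)\<close> over \<open>{-m..T}\<close>. As \<open>F < P\<close> strictly,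
  this factor can be absorbed for small \<open>\<eta>\<close>, with a margin \<open>\<delta>\<close>. Cancelling the integrals over \<open>{0..T}\<close>
  bounds the weighted square integral of \<open>x\<close> by the initial data, uniformly in \<open>T\<close>. The delay
  inequality at a single time turns this integral bound into a pointwise one.\<close>

lemma delay_inequality_exponential_decay:
  fixes P :: "real ^ 'n ^ 'n" and R :: "'N::finite \<Rightarrow> real ^ 'n ^ 'n" and \<tau> :: "'N \<Rightarrow> real"
  assumes \<tau>: "\<And>i. 0 < \<tau> i" "\<And>i. \<tau> i \<le> m"
    and R: "\<And>i v. 0 \<le> v \<bullet> (R i *v v)"
    and P: "pos_def P"
    and less: "pos_def (P - (\<Sum>i\<in>UNIV. (\<tau> i)\<^sup>2 *\<^sub>R R i))"
  obtains \<alpha> \<beta> where "\<alpha> > 0" "\<beta> > 0"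
    "\<And>x M t. \<lbrakk>\<And>c L T. (\<lambda>r. exp (c * r) * (x r \<bullet> (L *v x r))) integrable_on {-m..T};
        \<And>t. 0 \<le> t \<Longrightarrow> x t \<bullet> (P *v x t) \<le> (\<Sum>i\<in>UNIV. \<tau> i * integral {t - \<tau> i..t} (\<lambda>r. x r \<bullet> (R i *v x r)));
        \<And>s. s \<in> {-m..<0} \<Longrightarrow> norm (x s) \<le> M; 0 \<le> t\<rbrakk>
      \<Longrightarrow> norm (x t) \<le> \<alpha> * M * exp (- \<beta> * t)"
proof -
  define F where "F = (\<Sum>i\<in>UNIV. (\<tau> i)\<^sup>2 *\<^sub>R R i)"
  obtain p where p: "p > 0" "\<And>v. p * (v \<bullet> v) \<le> v \<bullet> (P *v v)"
    using pos_def_coercive[OF P] by blast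
  obtain d where d: "d > 0" "\<And>v. d * (v \<bullet> v) \<le> v \<bullet> ((P - F) *v v)"
    using pos_def_coercive[OF less] unfolding F_def by blast
  obtain c where c: "c > 0" "\<And>v. v \<bullet> (P *v v) \<le> c * (v \<bullet> v)"
    using quadratic_form_bound[of P] by blast
  obtain b where b: "b > 0" "\<And>v. v \<bullet> ((\<Sum>i\<in>UNIV. \<tau> i *\<^sub>R R i) *v v) \<le> b * (v \<bullet> v)"
    using quadratic_form_bound[of "\<Sum>i\<in>UNIV. \<tau> i *\<^sub>R R i"] by blast
  have m: "m > 0"
    using \<tau> by (meson less_le_trans)
  \<comment> \<open>\<open>\<eta> * c = d\<close> makes the margin \<open>d * (v \<bullet> v)\<close> cover the error \<open>\<eta> * (v \<bullet> P v)\<close> in \<open>(1 + \<eta>) * (v \<bullet> F v)\<close>,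
    so that \<open>\<eta> * d * (v \<bullet> v)\<close> is left over.\<close>
  define \<eta> where "\<eta> = d / c"
  define \<delta> where "\<delta> = \<eta> * d"
  define g where "g = ln (1 + \<eta>) / m"
  have \<eta>: "\<eta> > 0" and \<delta>: "\<delta> > 0"
    using c d by (auto simp: \<eta>_def \<delta>_def)
  have g: "g > 0" "exp (g * m) = 1 + \<eta>"
    using \<eta> m by (auto simp: g_def)
  have F: "(1 + \<eta>) * (v \<bullet> (F *v v)) \<le> v \<bullet> (P *v v) - \<delta> * (v \<bullet> v)" for v
  proof -
    have "(1 + \<eta>) * (v \<bullet> (F *v v)) \<le> (1 + \<eta>) * (v \<bullet> (P *v v) - d * (v \<bullet> v))"
      using d(2)[of v] \<eta> by (intro mult_left_mono) (auto simp: quadratic_form_diff)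
    also have "\<dots> \<le> v \<bullet> (P *v v) + \<eta> * (c * (v \<bullet> v)) - (1 + \<eta>) * (d * (v \<bullet> v))"
      using mult_left_mono[OF c(2)[of v], of \<eta>] \<eta> by (simp add: algebra_simps)
    also have "\<eta> * (c * (v \<bullet> v)) = d * (v \<bullet> v)"
      using c by (simp add: \<eta>_def)
    finally show ?thesis
      by (simp add: \<delta>_def algebra_simps)
  qed
  define C where "C = (1 + \<eta>) * (b * (c * m / \<delta>)) / p"
  have C: "C > 0"
    using p(1) b(1) c(1) m \<delta> \<eta> by (simp add: C_def)
  show thesis
  proof (rule that[of "sqrt C" "g / 2"])
    fix x :: "real \<Rightarrow> real ^ 'n" and M t :: real
    assume int: "\<And>c L T. (\<lambda>r. exp (c * r) * (x r \<bullet> (L *v x r))) integrable_on {-m..T}"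
      and ineq: "\<And>t. 0 \<le> t \<Longrightarrow>
        x t \<bullet> (P *v x t) \<le> (\<Sum>i\<in>UNIV. \<tau> i * integral {t - \<tau> i..t} (\<lambda>r. x r \<bullet> (R i *v x r)))"
      and M: "\<And>s. s \<in> {-m..<0} \<Longrightarrow> norm (x s) \<le> M"
      and "0 \<le> t"
    define q where "q L r = exp (g * r) * (x r \<bullet> (L *v x r))" for L r
    define J where "J L T = integral {-m..T} (q L)" for L T
    have q_int: "q L integrable_on {a..b}" if "-m \<le> a" for L a b
      unfolding q_def using int[of g L b]
      by (rule integrable_subinterval_real) (use that in auto)
    have qR: "0 \<le> q (R i) r" for i r
      using R by (simp add: q_def)
    have weighted: "q P t \<le> (\<Sum>i\<in>UNIV. (1 + \<eta>) * \<tau> i * integral {t - \<tau> i..t} (q (R i)))"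
      if "0 \<le> t" for t
    proof -
      have "exp (g * t) * integral {t - \<tau> i..t} (\<lambda>r. x r \<bullet> (R i *v x r))
          \<le> (1 + \<eta>) * integral {t - \<tau> i..t} (q (R i))" for i
      proof -
        have sub: "{t - \<tau> i..t} \<subseteq> {-m..t}"
          using \<tau>(2)[of i] that by auto
        have 1: "(\<lambda>r. x r \<bullet> (R i *v x r)) integrable_on {t - \<tau> i..t}"
          using integrable_subinterval_real[OF int[of 0 "R i" t] sub] by simp
        have 2: "q (R i) integrable_on {t - \<tau> i..t}"
          using \<tau>(2)[of i] that by (intro q_int) auto
        have "integral {t - \<tau> i..t} (\<lambda>r. exp (g * t) * (x r \<bullet> (R i *v x r)))
            \<le> integral {t - \<tau> i..t} (\<lambda>r. (1 + \<eta>) * q (R i) r)"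
        proof (rule integral_le)
          fix r assume r: "r \<in> {t - \<tau> i..t}"
          have "exp (g * t) = exp (g * (t - r)) * exp (g * r)"
            by (simp flip: exp_add add: algebra_simps)
          also have "\<dots> \<le> (1 + \<eta>) * exp (g * r)"
            using r \<tau>(2)[of i] g by (intro mult_right_mono) (auto simp flip: g(2))
          finally have "exp (g * t) \<le> (1 + \<eta>) * exp (g * r)" .
          from mult_right_mono[OF this R[of "x r" i]]
          show "exp (g * t) * (x r \<bullet> (R i *v x r)) \<le> (1 + \<eta>) * q (R i) r"
            by (simp add: q_def mult.assoc)
        qed (use 1 2 in \<open>auto intro!: integrable_on_mult_right\<close>)
        then show ?thesis
          by simp
      qed
      then have "(\<Sum>i\<in>UNIV. \<tau> i * (exp (g * t) * integral {t - \<tau> i..t} (\<lambda>r. x r \<bullet> (R i *v x r))))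
          \<le> (\<Sum>i\<in>UNIV. \<tau> i * ((1 + \<eta>) * integral {t - \<tau> i..t} (q (R i))))"
        using \<tau>(1) by (intro sum_mono mult_left_mono) (auto intro: less_imp_le)
      moreover have "q P t \<le> exp (g * t) * (\<Sum>i\<in>UNIV. \<tau> i * integral {t - \<tau> i..t} (\<lambda>r. x r \<bullet> (R i *v x r)))"
        unfolding q_def using ineq[OF that] by (intro mult_left_mono) auto
      ultimately show ?thesis
        by (simp add: sum_distrib_left mult_ac)
    qed
    have energy: "J (mat 1) T \<le> c * m / \<delta> * M\<^sup>2" if "0 \<le> T" for T
    proof -
      have "integral {0..T} (q P)
          \<le> integral {0..T} (\<lambda>t. \<Sum>i\<in>UNIV. (1 + \<eta>) * \<tau> i * integral {t - \<tau> i..t} (q (R i)))"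
        using \<tau> that weighted q_int m
        by (intro integral_le integrable_sum integrable_on_mult_right integral_sliding_window qR)
          (auto intro: less_imp_le)
      also have "\<dots> = (\<Sum>i\<in>UNIV. (1 + \<eta>) * \<tau> i * integral {0..T} (\<lambda>t. integral {t - \<tau> i..t} (q (R i))))"
        using \<tau> that weighted q_int m
        by (subst integral_sum)
          (auto intro!: integrable_on_mult_right integral_sliding_window qR intro: less_imp_le)
      also have "\<dots> \<le> (\<Sum>i\<in>UNIV. (1 + \<eta>) * \<tau> i * (\<tau> i * J (R i) T))"
      proof (intro sum_mono mult_left_mono)
        fix i
        have "integral {0..T} (\<lambda>t. integral {t - \<tau> i..t} (q (R i))) \<le> \<tau> i * integral {-\<tau> i..T} (q (R i))"
          using \<tau>[of i] that by (intro integral_sliding_window q_int qR) auto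
        also have "\<dots> \<le> \<tau> i * J (R i) T"
          unfolding J_def using \<tau>[of i] qR
          by (intro mult_left_mono integral_subset_le q_int) auto
        finally show "integral {0..T} (\<lambda>t. integral {t - \<tau> i..t} (q (R i))) \<le> \<tau> i * J (R i) T" .
      qed (use \<eta> \<tau>(1) in \<open>auto intro: less_imp_le\<close>)
      also have "\<dots> = integral {-m..T} (\<lambda>r. \<Sum>i\<in>UNIV. (1 + \<eta>) * \<tau> i * \<tau> i * q (R i) r)"
        by (subst integral_sum) (auto intro!: integrable_on_mult_right q_int simp: J_def mult.assoc)
      also have "\<dots> \<le> integral {-m..T} (\<lambda>r. q P r - \<delta> * q (mat 1) r)"
      proof (intro integral_le integrable_sum integrable_on_mult_right integrable_diff q_int)
        fix r
        have "(\<Sum>i\<in>UNIV. (1 + \<eta>) * \<tau> i * \<tau> i * q (R i) r) = exp (g * r) * ((1 + \<eta>) * (x r \<bullet> (F *v x r)))"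
          by (simp add: q_def F_def matrix_vector_mult_sum_left inner_sum_right sum_distrib_left
              power2_eq_square mult_ac flip: scaleR_matrix_vector_assoc)
        also have "\<dots> \<le> exp (g * r) * (x r \<bullet> (P *v x r) - \<delta> * (x r \<bullet> x r))"
          using F by (intro mult_left_mono) auto
        finally show "(\<Sum>i\<in>UNIV. (1 + \<eta>) * \<tau> i * \<tau> i * q (R i) r) \<le> q P r - \<delta> * q (mat 1) r"
          by (simp add: q_def algebra_simps)
      qed auto
      also have "\<dots> = J P T - \<delta> * J (mat 1) T"
        by (simp add: J_def q_int integral_diff integrable_on_mult_right)
      also have "J P T = integral {-m..0} (q P) + integral {0..T} (q P)"
        unfolding J_def using m that q_int by (simp add: Henstock_Kurzweil_Integration.integral_combine)
      finally have "\<delta> * J (mat 1) T \<le> integral {-m..0} (q P)"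
        by simp
      \<comment> \<open>At \<open>r = 0\<close> the solution may jump away from the initial function, so \<open>M\<close> does not bound it.\<close>
      also have "\<dots> = integral {-m..0} (\<lambda>r. if r = 0 then 0 else q P r)"
        by (rule integral_spike[of "{0}"]) auto
      also have "\<dots> \<le> integral {-m..0} (\<lambda>r. c * M\<^sup>2)"
      proof (rule integral_le)
        show "(\<lambda>r. if r = 0 then 0 else q P r) integrable_on {-m..0}"
          by (rule integrable_spike_finite[of "{0}" _ _ "q P"]) (auto intro: q_int)
        fix r assume r: "r \<in> {-m..0}"
        show "(if r = 0 then 0 else q P r) \<le> c * M\<^sup>2"
        proof (cases "r = 0")
          case False
          have "q P r \<le> 1 * (x r \<bullet> (P *v x r))"
            unfolding q_def using r g pos_def_nonneg[OF P]
            by (intro mult_right_mono) (auto simp: mult_nonneg_nonpos)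
          also have "\<dots> \<le> c * (norm (x r))\<^sup>2"
            using c(2) by (simp add: power2_norm_eq_inner)
          also have "\<dots> \<le> c * M\<^sup>2"
            using M[of r] r False c(1) by (intro mult_left_mono power_mono) auto
          finally show ?thesis
            using False by simp
        qed (use c in auto)
      qed auto
      also have "\<dots> = c * m * M\<^sup>2"
        using m by simp
      finally show ?thesis
        using \<delta> by (simp add: field_simps)
    qed
    have "exp (g * t) * (p * (x t \<bullet> x t)) \<le> q P t"
      unfolding q_def using p(2) by (intro mult_left_mono) auto
    also have "\<dots> \<le> (\<Sum>i\<in>UNIV. (1 + \<eta>) * \<tau> i * integral {t - \<tau> i..t} (q (R i)))"
      using \<open>0 \<le> t\<close> by (rule weighted)
    also have "\<dots> \<le> (\<Sum>i\<in>UNIV. (1 + \<eta>) * \<tau> i * J (R i) t)"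
    proof (intro sum_mono mult_left_mono)
      fix i show "integral {t - \<tau> i..t} (q (R i)) \<le> J (R i) t"
        unfolding J_def using \<tau>[of i] qR \<open>0 \<le> t\<close> by (intro integral_subset_le q_int) auto
    qed (use \<eta> \<tau>(1) in \<open>auto intro: less_imp_le\<close>)
    also have "\<dots> = integral {-m..t} (\<lambda>r. \<Sum>i\<in>UNIV. (1 + \<eta>) * \<tau> i * q (R i) r)"
      by (subst integral_sum) (auto intro!: integrable_on_mult_right q_int simp: J_def)
    also have "\<dots> \<le> integral {-m..t} (\<lambda>r. (1 + \<eta>) * (b * q (mat 1) r))"
    proof (intro integral_le integrable_sum integrable_on_mult_right q_int)
      fix r
      have "(\<Sum>i\<in>UNIV. (1 + \<eta>) * \<tau> i * q (R i) r)
          = exp (g * r) * ((1 + \<eta>) * (x r \<bullet> ((\<Sum>i\<in>UNIV. \<tau> i *\<^sub>R R i) *v x r)))"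
        by (simp add: q_def matrix_vector_mult_sum_left inner_sum_right sum_distrib_left
            mult_ac flip: scaleR_matrix_vector_assoc)
      also have "\<dots> \<le> exp (g * r) * ((1 + \<eta>) * (b * (x r \<bullet> x r)))"
        using b(2) \<eta> by (intro mult_left_mono) auto
      finally show "(\<Sum>i\<in>UNIV. (1 + \<eta>) * \<tau> i * q (R i) r) \<le> (1 + \<eta>) * (b * q (mat 1) r)"
        by (simp add: q_def mult_ac)
    qed auto
    also have "\<dots> = (1 + \<eta>) * (b * J (mat 1) t)"
      by (simp add: J_def)
    also have "\<dots> \<le> (1 + \<eta>) * (b * (c * m / \<delta> * M\<^sup>2))"
      using energy[OF \<open>0 \<le> t\<close>] b(1) \<eta> by (intro mult_left_mono) auto
    finally have "exp (g * t) * (p * (x t \<bullet> x t)) \<le> (1 + \<eta>) * (b * (c * m / \<delta> * M\<^sup>2))" .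
    then have "exp (g * t) * (p * (x t \<bullet> x t)) * (exp (- g * t) / p)
        \<le> (1 + \<eta>) * (b * (c * m / \<delta> * M\<^sup>2)) * (exp (- g * t) / p)"
      using p(1) by (intro mult_right_mono) auto
    moreover have "exp (g * t) * (p * (x t \<bullet> x t)) * (exp (- g * t) / p) = (norm (x t))\<^sup>2"
      using p(1) by (simp add: exp_minus power2_norm_eq_inner)
    ultimately have "(norm (x t))\<^sup>2 \<le> C * M\<^sup>2 * exp (- g * t)"
      by (simp add: C_def mult_ac)
    also have "\<dots> = (sqrt C * M * exp (- (g / 2) * t))\<^sup>2"
      using C by (simp add: power_mult_distrib flip: exp_double)
    finally show "norm (x t) \<le> sqrt C * M * exp (- (g / 2) * t)"
    proof (rule power2_le_imp_le)
      have "0 \<le> M"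
        using order_trans[OF norm_ge_zero M[of "-m"]] m by simp
      then show "0 \<le> sqrt C * M * exp (- (g / 2) * t)"
        using C by simp
    qed
  qed (use C g in auto)
qed

section \<open>Solutions of the integral delay system\<close>

lemma max_delay:
  fixes \<tau> :: "'N::finite \<Rightarrow> real"
  shows "\<tau> i \<le> max_delay \<tau>" and "\<exists>i. \<tau> i = max_delay \<tau>"
proof -
  show "\<tau> i \<le> max_delay \<tau>"
    by (simp add: max_delay_def)
  have "Max (range \<tau>) \<in> range \<tau>"
    by (rule Max_in) auto
  then show "\<exists>i. \<tau> i = max_delay \<tau>"
    unfolding max_delay_def by (metis imageE)
qed

lemma ids_solution_window:
  assumes "ids_solution A \<tau> \<phi> x" "0 \<le> t"
  shows "x integrable_on {t - \<tau> i..t}"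
    and "x t = (\<Sum>i\<in>UNIV. A i *v integral {t - \<tau> i..t} x)"
proof -
  have "(\<lambda>s. x (s + t)) integrable_on {t - \<tau> i - t..t - t}"
    using assms by (simp add: ids_solution_def add.commute[of _ t])
  then show "x integrable_on {t - \<tau> i..t}"
    by (simp only: integrable_shift_real_ivl_iff)
  have "integral {- \<tau> i..0} (\<lambda>s. x (t + s)) = integral {t - \<tau> i..t} x" for i
    using integral_shift_real_ivl[of "t - \<tau> i" t t x] by (simp add: add.commute)
  then show "x t = (\<Sum>i\<in>UNIV. A i *v integral {t - \<tau> i..t} x)"
    using assms by (simp add: ids_solution_def)
qed

text \<open>The defining equation at the times \<open>0, m, 2 m, \<dots>\<close>, with \<open>m\<close> the largest delay, gives integrability
  on adjacent intervals of length \<open>m\<close>.\<close>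

lemma ids_solution_integrable:
  assumes sol: "ids_solution A \<tau> \<phi> x" and \<tau>: "\<And>i. 0 < \<tau> i"
  shows "x integrable_on {- max_delay \<tau>..T}"
proof -
  obtain i where i: "\<tau> i = max_delay \<tau>"
    using max_delay(2)[of \<tau>] by blast
  define m where "m = max_delay \<tau>"
  have m: "m > 0" "\<tau> i = m"
    using i \<tau>[of i] by (simp_all add: m_def)
  have "x integrable_on {- m..real k * m}" for k
  proof (induction k)
    case 0
    then show ?case
      using ids_solution_window(1)[OF sol, of 0 i] m by simp
  next
    case (Suc k)
    have "x integrable_on {real (Suc k) * m - m..real (Suc k) * m}"
      using ids_solution_window(1)[OF sol, of "real (Suc k) * m" i] m by simp
    then have "x integrable_on {real k * m..real (Suc k) * m}"
      by (simp add: algebra_simps)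
    with Suc show ?case
      using m(1) by (intro Henstock_Kurzweil_Integration.integrable_combine[of "-m" "real k * m" "real (Suc k) * m" x])
        (auto simp: algebra_simps intro: order_trans[of _ 0])
  qed
  moreover obtain k :: nat where "T < real k * m"
    using reals_Archimedean3[OF m(1)] by blast
  then have "{-m..T} \<subseteq> {-m..real k * m}"
    by simp
  ultimately show ?thesis
    unfolding m_def[symmetric] by (rule integrable_subinterval_real)
qed

text \<open>For \<open>t \<ge> 0\<close> the right-hand side is built from indefinite integrals of \<open>x\<close>. Continuity, unlike
  integrability, passes to the quadratic forms of \<open>x\<close> needed below.\<close>

lemma ids_solution_continuous:
  assumes sol: "ids_solution A \<tau> \<phi> x" and \<tau>: "\<And>i. 0 < \<tau> i"
  shows "continuous_on {0..T} x"
proof -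
  define m where "m = max_delay \<tau>"
  define X where "X u = integral {-m..u} x" for u
  have int: "x integrable_on {-m..u}" for u
    unfolding m_def using sol \<tau> by (rule ids_solution_integrable)
  have \<tau>m: "\<tau> i \<le> m" for i
    unfolding m_def by (rule max_delay)
  have X: "continuous_on {-m..T} X"
    unfolding X_def by (rule indefinite_integral_continuous_1[OF int])
  have "continuous_on {0..T} (\<lambda>t. \<Sum>i\<in>UNIV. A i *v (X t - X (t - \<tau> i)))"
  proof (intro continuous_intros bounded_linear.continuous_on[OF matrix_vector_mul_bounded_linear])
    fix i
    show "continuous_on {0..T} X"
      by (rule continuous_on_subset[OF X]) (use \<tau>[of i] \<tau>m[of i] in auto)
    show "continuous_on {0..T} (\<lambda>t. X (t - \<tau> i))"
      by (rule continuous_on_compose2[OF X])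
        (use \<tau>[of i] \<tau>m[of i] in \<open>auto intro!: continuous_intros\<close>)
  qed
  moreover have "x t = (\<Sum>i\<in>UNIV. A i *v (X t - X (t - \<tau> i)))" if "t \<in> {0..T}" for t
  proof -
    have "integral {t - \<tau> i..t} x = X t - X (t - \<tau> i)" for i
      using Henstock_Kurzweil_Integration.integral_combine[of "-m" "t - \<tau> i" t x] int \<tau>[of i] \<tau>m[of i] that
      by (auto simp: X_def algebra_simps)
    then show ?thesis
      using ids_solution_window(2)[OF sol] that by simp
  qed
  ultimately show ?thesis
    by (auto intro: continuous_on_eq)
qed

lemma ids_solution_weighted_quadratic_integrable:
  fixes x :: "real \<Rightarrow> real ^ 'n::finite"
  assumes sol: "ids_solution A \<tau> \<phi> x" and \<tau>: "\<And>i. 0 < \<tau> i"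
    and \<phi>: "continuous_on {- max_delay \<tau>..0} \<phi>"
  shows "(\<lambda>r. exp (c * r) * (x r \<bullet> (L *v x r))) integrable_on {- max_delay \<tau>..T}"
proof -
  define m where "m = max_delay \<tau>"
  have m: "m > 0"
    unfolding m_def using max_delay(2)[of \<tau>] \<tau> by metis
  have q: "(\<lambda>r. exp (c * r) * (y r \<bullet> (L *v y r))) integrable_on {a..b}"
    if "continuous_on {a..b} y" for y :: "real \<Rightarrow> real ^ 'n" and a b
    using that by (intro integrable_continuous_interval continuous_intros
        bounded_linear.continuous_on[OF matrix_vector_mul_bounded_linear])
  \<comment> \<open>On \<open>{-m..0}\<close> the solution differs from the continuous \<open>\<phi>\<close> at most at the end point \<open>0\<close>.\<close>
  have neg: "(\<lambda>r. exp (c * r) * (x r \<bullet> (L *v x r))) integrable_on {-m..0}"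
  proof (rule integrable_spike_finite[of "{0}"])
    show "(\<lambda>r. exp (c * r) * (\<phi> r \<bullet> (L *v \<phi> r))) integrable_on {-m..0}"
      using \<phi> unfolding m_def by (rule q)
    show "exp (c * r) * (x r \<bullet> (L *v x r)) = exp (c * r) * (\<phi> r \<bullet> (L *v \<phi> r))"
      if "r \<in> {-m..0} - {0}" for r
      using sol that by (simp add: ids_solution_def m_def)
  qed auto
  have "(\<lambda>r. exp (c * r) * (x r \<bullet> (L *v x r))) integrable_on {-m..max 0 T}"
    using m by (intro Henstock_Kurzweil_Integration.integrable_combine[OF _ _ neg] q ids_solution_continuous[OF sol \<tau>]) auto
  then show ?thesis
    unfolding m_def[symmetric] by (rule integrable_subinterval_real) auto
qed

text \<open>The value \<open>x t\<close> is the sum of the vectors \<open>A i *v y i\<close>, where \<open>y i\<close> is the \<open>i\<close>th window integral.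
  Subadditivity splits the form of the sum, and the Cauchy-Schwarz inequality moves each form inside
  its integral.\<close>

lemma ids_solution_quadratic_inequality:
  fixes A Q :: "'N::finite \<Rightarrow> real ^ 'n::finite ^ 'n"
  assumes sol: "ids_solution A \<tau> \<phi> x" and \<tau>: "\<And>i. 0 < \<tau> i"
    and \<phi>: "continuous_on {- max_delay \<tau>..0} \<phi>"
    and Q: "\<And>i. pos_def (Q i)" and t: "0 \<le> t"
  shows "x t \<bullet> (matrix_inv (\<Sum>i\<in>UNIV. Q i) *v x t)
    \<le> (\<Sum>i\<in>UNIV. \<tau> i * integral {t - \<tau> i..t}
          (\<lambda>r. x r \<bullet> ((transpose (A i) ** matrix_inv (Q i) ** A i) *v x r)))"
proof -
  define y where "y i = integral {t - \<tau> i..t} x" for i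
  define R where "R i = transpose (A i) ** matrix_inv (Q i) ** A i" for i
  have R: "v \<bullet> (R i *v v) = (A i *v v) \<bullet> (matrix_inv (Q i) *v (A i *v v))" for i v
    using inner_matrix_vector_transpose[of v "transpose (A i)"]
    by (simp add: R_def flip: matrix_vector_mul_assoc)
  have xt: "x t = (\<Sum>i\<in>UNIV. A i *v y i)"
    unfolding y_def using sol t by (rule ids_solution_window(2))
  have "x t \<bullet> (matrix_inv (\<Sum>i\<in>UNIV. Q i) *v x t) \<le> (\<Sum>i\<in>UNIV. y i \<bullet> (R i *v y i))"
    unfolding xt R using Q by (intro quadratic_sum_le) auto
  also have "\<dots> \<le> (\<Sum>i\<in>UNIV. \<tau> i * integral {t - \<tau> i..t} (\<lambda>r. x r \<bullet> (R i *v x r)))"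
  proof (rule sum_mono)
    fix i
    have sub: "{t - \<tau> i..t} \<subseteq> {- max_delay \<tau>..t}"
      using max_delay(1)[of \<tau> i] t by auto
    have "(\<lambda>r. x r \<bullet> (R i *v x r)) integrable_on {t - \<tau> i..t}"
      using integrable_subinterval_real[OF
          ids_solution_weighted_quadratic_integrable[OF sol \<tau> \<phi>, of 0] sub] by simp
    then have "y i \<bullet> (R i *v y i) \<le> (t - (t - \<tau> i)) * integral {t - \<tau> i..t} (\<lambda>r. x r \<bullet> (R i *v x r))"
      unfolding y_def using \<tau>[of i] pos_def_nonneg[OF pos_def_inverse(5)[OF Q]]
      by (intro quadratic_integral_Cauchy_Schwarz ids_solution_window(1)[OF sol t]) (auto simp: R)
    then show "y i \<bullet> (R i *v y i) \<le> \<tau> i * integral {t - \<tau> i..t} (\<lambda>r. x r \<bullet> (R i *v x r))"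
      by simp
  qed
  finally show ?thesis
    by (simp add: R_def)
qed

lemma ids_stable_if_lmi:
  fixes A Q :: "'N::finite \<Rightarrow> real ^ 'n::finite ^ 'n"
  assumes \<tau>: "\<And>i. 0 < \<tau> i" and Q: "\<And>i. pos_def (Q i)"
    and lmi: "(\<Sum>i\<in>UNIV. (\<tau> i)\<^sup>2 *\<^sub>R (transpose (A i) ** matrix_inv (Q i) ** A i))
              - matrix_inv (\<Sum>i\<in>UNIV. Q i) \<prec> 0"
  shows "ids_exponentially_stable A \<tau>"
proof -
  define R where "R i = transpose (A i) ** matrix_inv (Q i) ** A i" for i
  define P where "P = matrix_inv (\<Sum>i\<in>UNIV. Q i)"
  have R: "0 \<le> v \<bullet> (R i *v v)" for i v
    using inner_matrix_vector_transpose[of v "transpose (A i)"]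
      pos_def_nonneg[OF pos_def_inverse(5)[OF Q]]
    by (simp add: R_def flip: matrix_vector_mul_assoc)
  have P: "pos_def P"
    unfolding P_def using Q by (intro pos_def_inverse pos_def_sum) auto
  have less: "pos_def (P - (\<Sum>i\<in>UNIV. (\<tau> i)\<^sup>2 *\<^sub>R R i))"
    using lmi by (simp add: loewner_less_diff_zero P_def R_def)
  show ?thesis
  proof (rule delay_inequality_exponential_decay[of \<tau> "max_delay \<tau>" R P, OF \<tau> max_delay(1) R P less])
    fix \<alpha> \<beta> :: real
    assume "\<alpha> > 0" "\<beta> > 0" and decay:
      "\<And>x M t. \<lbrakk>\<And>c L T. (\<lambda>r. exp (c * r) * (x r \<bullet> (L *v x r))) integrable_on {- max_delay \<tau>..T};
          \<And>t. 0 \<le> t \<Longrightarrow> x t \<bullet> (P *v x t) \<le> (\<Sum>i\<in>UNIV. \<tau> i * integral {t - \<tau> i..t} (\<lambda>r. x r \<bullet> (R i *v x r)));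
          \<And>s. s \<in> {- max_delay \<tau>..<0} \<Longrightarrow> norm (x s) \<le> M; 0 \<le> t\<rbrakk>
        \<Longrightarrow> norm (x t) \<le> \<alpha> * M * exp (- \<beta> * t)"
    have "norm (x t) \<le> \<alpha> * (SUP s\<in>{- max_delay \<tau>..<0}. norm (\<phi> s)) * exp (- \<beta> * t)"
      if \<phi>: "continuous_on {- max_delay \<tau>..0} \<phi>" and sol: "ids_solution A \<tau> \<phi> x" and "0 \<le> t"
      for \<phi> x t
    proof (rule decay)
      show "(\<lambda>r. exp (c * r) * (x r \<bullet> (L *v x r))) integrable_on {- max_delay \<tau>..T}" for c L T
        using sol \<tau> \<phi> by (rule ids_solution_weighted_quadratic_integrable)
      show "x u \<bullet> (P *v x u) \<le> (\<Sum>i\<in>UNIV. \<tau> i * integral {u - \<tau> i..u} (\<lambda>r. x r \<bullet> (R i *v x r)))"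
        if "0 \<le> u" for u
        unfolding P_def R_def using sol \<tau> \<phi> Q that by (rule ids_solution_quadratic_inequality)
      have "bounded (\<phi> ` {- max_delay \<tau>..0})"
        by (intro compact_imp_bounded compact_continuous_image \<phi> compact_Icc)
      then have "bdd_above ((\<lambda>s. norm (\<phi> s)) ` {- max_delay \<tau>..<0})"
        unfolding bounded_iff bdd_above_def by force
      then show "norm (x s) \<le> (SUP s\<in>{- max_delay \<tau>..<0}. norm (\<phi> s))"
        if "s \<in> {- max_delay \<tau>..<0}" for s
        using that sol by (auto simp: ids_solution_def intro: cSUP_upper)
    qed fact
    with \<open>\<alpha> > 0\<close> \<open>\<beta> > 0\<close> show ?thesis
      unfolding ids_exponentially_stable_def by blast
  qed
qed

text \<open>Not only solvability but each single solution \<open>Q\<close> carries over: the two inequalities are the two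
  Schur complements for \<open>D = block_diag Q\<close>, \<open>S = (\<Sum>i. Q i)\<close> and the block column \<open>B\<close>.\<close>

lemma lmi_iff_block_lmi:
  fixes A Q :: "'N::finite \<Rightarrow> real ^ 'n::finite ^ 'n"
  assumes Q: "\<And>i. pos_def (Q i)"
  shows "(\<Sum>i\<in>UNIV. (\<tau> i)\<^sup>2 *\<^sub>R (transpose (A i) ** matrix_inv (Q i) ** A i))
        - matrix_inv (\<Sum>i\<in>UNIV. Q i) \<prec> 0
    \<longleftrightarrow> (\<Sum>i\<in>UNIV. block_column (\<lambda>j. \<tau> j *\<^sub>R A j) ** Q i
            ** transpose (block_column (\<lambda>j. \<tau> j *\<^sub>R A j))) - block_diag Q \<prec> 0"
proof -
  define B where "B = block_column (\<lambda>j. \<tau> j *\<^sub>R A j)"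
  have "transpose B ** matrix_inv (block_diag Q) ** B
      = transpose B ** (matrix_inv (block_diag Q) ** B)"
    by (simp add: matrix_mul_assoc)
  also have "\<dots> = (\<Sum>i\<in>UNIV. transpose (\<tau> i *\<^sub>R A i) ** (matrix_inv (Q i) ** (\<tau> i *\<^sub>R A i)))"
    by (simp add: B_def block_diag_inverse[OF Q] block_diag_mult_block_column
        transpose_block_column_mult)
  also have "\<dots> = (\<Sum>i\<in>UNIV. (\<tau> i)\<^sup>2 *\<^sub>R (transpose (A i) ** matrix_inv (Q i) ** A i))"
    by (simp add: transpose_scalar matrix_scalar_ac scalar_matrix_assoc power2_eq_square
        matrix_mul_assoc)
  finally have 1: "transpose B ** matrix_inv (block_diag Q) ** B
      = (\<Sum>i\<in>UNIV. (\<tau> i)\<^sup>2 *\<^sub>R (transpose (A i) ** matrix_inv (Q i) ** A i))" .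
  have 2: "(\<Sum>i\<in>UNIV. B ** Q i ** transpose B) = B ** (\<Sum>i\<in>UNIV. Q i) ** transpose B"
    by (simp add: matrix_eq matrix_vector_mult_sum_left linear_sum[OF matrix_vector_mul_linear]
        flip: matrix_vector_mul_assoc)
  have "pos_def (\<Sum>i\<in>UNIV. Q i)"
    using Q by (intro pos_def_sum) auto
  from schur_complement_iff[OF pos_def_block_diag[of Q, OF Q] this, of B]
  show ?thesis
    by (simp add: loewner_less_diff_zero 1 2 flip: B_def)
qed

theorem theorem2:
  fixes A :: "'N::finite \<Rightarrow> real ^ 'n::finite ^ 'n"
    and \<tau> :: "'N \<Rightarrow> real"
  assumes "\<And>i. \<tau> i > 0"
  shows "((\<exists>Q :: 'N \<Rightarrow> real ^ 'n ^ 'n. (\<forall>i. pos_def (Q i)) \<and>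
            (\<Sum>i\<in>UNIV. (\<tau> i)\<^sup>2 *\<^sub>R (transpose (A i) ** matrix_inv (Q i) ** A i))
              - matrix_inv (\<Sum>i\<in>UNIV. Q i) \<prec> 0)
          \<longrightarrow> ids_exponentially_stable A \<tau>)
       \<and> ((\<exists>Q :: 'N \<Rightarrow> real ^ 'n ^ 'n. (\<forall>i. pos_def (Q i)) \<and>
            (\<Sum>i\<in>UNIV. (\<tau> i)\<^sup>2 *\<^sub>R (transpose (A i) ** matrix_inv (Q i) ** A i))
              - matrix_inv (\<Sum>i\<in>UNIV. Q i) \<prec> 0)
          \<longleftrightarrow>
          (\<exists>Q :: 'N \<Rightarrow> real ^ 'n ^ 'n. (\<forall>i. pos_def (Q i)) \<and>
            (\<Sum>i\<in>UNIV. block_column (\<lambda>j. \<tau> j *\<^sub>R A j) ** Q i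
                         ** transpose (block_column (\<lambda>j. \<tau> j *\<^sub>R A j)))
              - block_diag Q \<prec> 0))"
  using assms ids_stable_if_lmi[of \<tau> _ A] lmi_iff_block_lmi[of _ \<tau> A] by blast

end
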